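(* Let $R\subseteq S$ be an extension of commutative rings which is SL, that is, $\mathrm U(R)=\mathrm U(S)$. Then $S$ is $\mathrm J$-regular if and only if $R$ is $\mathrm J$-regular and the extension $R\subseteq S$ is integral and seminormal. If these (equivalent) conditions hold, then $\mathrm J(R)=\mathrm J(S)$.
   Context: All rings are commutative, unital and nonzero. $\mathrm U(R)$ denotes the group of units and $\mathrm J(R)$ the Jacobson radical of a ring $R$. A ring $A$ is (von Neumann) regular if for each $x\in A$ there is $y\in A$ with $x^2y=x$. A ring $R$ is $\mathrm J$-regular if $R/\mathrm J(R)$ is von Neumann regular. An extension $R\subseteq S$ is strongly local (SL) if $\mathrm U(R)=\mathrm U(S)$. An extension $R\subseteq S$ is seminormal if every $b\in S$ with $b^2\in R$ and $b^3\in R$ belongs to $R$. *)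

theory Defs
  imports "HOL-Algebra.Algebra"
begin

text \<open>
  An extension \<open>R \<subseteq> S\<close> is a subring \<open>R\<close> (a set, containing the one of \<open>S\<close>) of a commutative ring
  \<open>S\<close>; the ring structure of \<open>R\<close> is \<open>S \<lparr>carrier := R\<rparr>\<close>.
\<close>

text \<open>The intersection with the carrier only matters for the zero ring, where there is no
  maximal ideal.\<close>

definition jacobson_radical :: "('a, 'b) ring_scheme \<Rightarrow> 'a set" where
  "jacobson_radical A = carrier A \<inter> \<Inter> {M. maximalideal M A}"

definition regular_ring :: "('a, 'b) ring_scheme \<Rightarrow> bool" where
  "regular_ring A \<longleftrightarrow>
     (\<forall>x \<in> carrier A. \<exists>y \<in> carrier A. x [^]\<^bsub>A\<^esub> (2::nat) \<otimes>\<^bsub>A\<^esub> y = x)"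

definition J_regular :: "('a, 'b) ring_scheme \<Rightarrow> bool" where
  "J_regular A \<longleftrightarrow> regular_ring (A Quot jacobson_radical A)"

definition strongly_local_extension :: "'a set \<Rightarrow> ('a, 'b) ring_scheme \<Rightarrow> bool" where
  "strongly_local_extension R S \<longleftrightarrow> Units (S \<lparr>carrier := R\<rparr>) = Units S"

definition seminormal_extension :: "'a set \<Rightarrow> ('a, 'b) ring_scheme \<Rightarrow> bool" where
  "seminormal_extension R S \<longleftrightarrow>
     (\<forall>b \<in> carrier S. b [^]\<^bsub>S\<^esub> (2::nat) \<in> R \<and> b [^]\<^bsub>S\<^esub> (3::nat) \<in> R \<longrightarrow> b \<in> R)"

text \<open>Elements of \<open>R[X]\<close> are coefficient lists with leading coefficient first. The condition
  \<open>p \<noteq> []\<close> excludes the zero polynomial, whose \<open>lead_coeff\<close> is the unspecified \<open>hd []\<close>.\<close>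

definition integral_extension :: "'a set \<Rightarrow> ('a, 'b) ring_scheme \<Rightarrow> bool" where
  "integral_extension R S \<longleftrightarrow>
     (\<forall>s \<in> carrier S. \<exists>p \<in> carrier (R[X]\<^bsub>S\<^esub>).
        p \<noteq> [] \<and> Polynomials.lead_coeff p = \<one>\<^bsub>S\<^esub> \<and> ring.eval S p s = \<zero>\<^bsub>S\<^esub>)"

end

theory Submission
  imports Defs
begin

text \<open>
  A ring is J-regular iff every element \<open>x\<close> satisfies \<open>x\<^sup>2 - u x \<in> J\<close> for some unit \<open>u\<close>, where \<open>J\<close>
  is the Jacobson radical. In a strongly local extension \<open>R \<subseteq> S\<close> the units of \<open>S\<close> and
  \<open>J(S) \<subseteq> U(S) - 1\<close> lie in \<open>R\<close>. So if \<open>S\<close> is J-regular, then \<open>x\<^sup>2 - u x\<close> is a constant of \<open>R\<close>, which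
  makes \<open>x\<close> integral, and \<open>x\<^sup>2 \<in> R\<close> forces \<open>u x \<in> R\<close>, hence \<open>x \<in> R\<close>. Conversely, integrality gives
  \<open>J(R) = J(S) = J\<close> and, since \<open>R/J\<close> is regular, for each \<open>s\<close> some \<open>N\<close> and \<open>y\<close> with
  \<open>s\<^sup>N (1 + s y) \<in> J\<close>. Seminormality makes \<open>J\<close> a radical ideal of \<open>S\<close>, so \<open>s + s\<^sup>2 y \<in> J\<close>.
\<close>

section \<open>Maximal ideals and the Jacobson radical\<close>

text \<open>Zorn's lemma for the ideals above \<open>I\<close> that avoid \<open>\<one>\<close>.
  Properness is the absence of a single element, so it survives unions of nonempty chains; the empty
  chain is bounded by \<open>I\<close>.\<close>

lemma (in ring) maximalideal_exists:
  assumes "ideal I R" "\<one> \<notin> I"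
  shows "\<exists>M. maximalideal M R \<and> I \<subseteq> M"
proof -
  let ?F = "{J. ideal J R \<and> I \<subseteq> J \<and> \<one> \<notin> J}"
  have "\<exists>M\<in>?F. \<forall>J\<in>?F. M \<subseteq> J \<longrightarrow> J = M"
  proof (rule subset_Zorn)
    fix C assume C: "subset.chain ?F C"
    show "\<exists>U\<in>?F. \<forall>J\<in>C. J \<subseteq> U"
    proof (cases "C = {}")
      case True
      then show ?thesis using assms by auto
    next
      case False
      have "subset.chain {J. ideal J R} C"
        using C unfolding pred_on.chain_def by auto
      from chain_Union_is_ideal[OF this] False have "ideal (\<Union>C) R" by simp
      moreover have "I \<subseteq> \<Union>C" "\<one> \<notin> \<Union>C"
        using C False unfolding pred_on.chain_def by blast+
      ultimately show ?thesis by blast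
    qed
  qed
  then obtain M where F: "M \<in> ?F" and max: "\<forall>J\<in>?F. M \<subseteq> J \<longrightarrow> J = M" ..
  from F have M: "ideal M R" "I \<subseteq> M" "\<one> \<notin> M" by simp_all
  have "maximalideal M R"
  proof (rule maximalidealI[OF M(1)])
    show "carrier R \<noteq> M" using M(3) by auto
    show "J = M \<or> J = carrier R" if J: "ideal J R" "M \<subseteq> J" for J
    proof (cases "\<one> \<in> J")
      case True
      then show ?thesis using ideal.one_imp_carrier[OF J(1)] by simp
    next
      case False
      then have "J \<in> ?F" using J M(2) by simp
      then show ?thesis using max J(2) by simp
    qed
  qed
  with M(2) show ?thesis by blast
qed

context cring
begin

lemma ideal_jacobson_radical: "ideal (jacobson_radical R) R"
proof -
  \<comment> \<open>Inserting the carrier makes the family nonempty even for the zero ring, as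
    \<open>i_Intersect\<close> requires.\<close>
  have "jacobson_radical R = \<Inter> (insert (carrier R) {M. maximalideal M R})"
    by (simp add: jacobson_radical_def)
  also have "ideal \<dots> R"
    by (rule i_Intersect) (auto simp: oneideal maximalideal_def)
  finally show ?thesis .
qed

text \<open>A nonunit \<open>1 + a x\<close> lies in some maximal ideal, which also contains
  \<open>x\<close> and hence \<open>1\<close>. Conversely, if a maximal ideal \<open>M\<close>
  misses \<open>x\<close>, then \<open>M + (x)\<close> is the whole ring, so \<open>M\<close>
  contains some \<open>1 - b x\<close>, a unit by assumption.\<close>

lemma mem_jacobson_radical_iff:
  "x \<in> jacobson_radical R \<longleftrightarrow> x \<in> carrier R \<and> (\<forall>a\<in>carrier R. \<one> \<oplus> a \<otimes> x \<in> Units R)"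
proof (intro iffI conjI ballI)
  assume x: "x \<in> jacobson_radical R"
  then show xc: "x \<in> carrier R" by (simp add: jacobson_radical_def)
  fix a assume a: "a \<in> carrier R"
  let ?w = "\<one> \<oplus> a \<otimes> x"
  have w: "?w \<in> carrier R" using a xc by simp
  show "?w \<in> Units R"
  proof (rule ccontr)
    assume nu: "?w \<notin> Units R"
    have "\<one> \<notin> PIdl ?w"
    proof
      assume "\<one> \<in> PIdl ?w"
      then obtain b where "b \<in> carrier R" "b \<otimes> ?w = \<one>" unfolding cgenideal_def by force
      then show False using nu w unfolding Units_def by (auto simp: m_comm)
    qed
    then obtain M where M: "maximalideal M R" "PIdl ?w \<subseteq> M"
      using maximalideal_exists[OF cgenideal_ideal[OF w]] by blast
    interpret M: maximalideal M R by (rule M(1))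
    have "?w \<in> M" using M(2) cgenideal_self[OF w] by blast
    moreover have "x \<in> M" using x M(1) by (auto simp: jacobson_radical_def)
    then have "a \<otimes> x \<in> M" using a by (rule M.I_l_closed)
    ultimately have "?w \<oplus> \<ominus> (a \<otimes> x) \<in> M" by simp
    moreover have "?w \<oplus> \<ominus> (a \<otimes> x) = \<one>" using a xc by algebra
    ultimately show False using M.one_imp_carrier M.I_notcarr by auto
  qed
next
  assume x: "x \<in> carrier R \<and> (\<forall>a\<in>carrier R. \<one> \<oplus> a \<otimes> x \<in> Units R)"
  then have xc: "x \<in> carrier R" by blast
  have "x \<in> M" if "maximalideal M R" for M
  proof (rule ccontr)
    assume nx: "x \<notin> M"
    interpret M: maximalideal M R by (rule that)
    let ?N = "M <+>\<^bsub>R\<^esub> PIdl x"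
    have I: "ideal ?N R"
      by (rule add_ideals[OF M.ideal_axioms cgenideal_ideal[OF xc]])
    have z: "\<zero> \<in> PIdl x"
      using cgenideal_ideal[OF xc] by (simp add: additive_subgroup.zero_closed ideal.axioms(1))
    have sub: "M \<subseteq> ?N"
      proof
      fix m assume m: "m \<in> M"
      then have "m = m \<oplus> \<zero>" using M.a_Hcarr by simp
      then show "m \<in> ?N" using m z unfolding set_add_def' by blast
    qed
    have "x \<in> ?N"
    proof -
      have "x = \<zero> \<oplus> x" using xc by simp
      then show ?thesis
        using cgenideal_self[OF xc] M.zero_closed unfolding set_add_def' by blast
    qed
    then have "?N = carrier R"
      using M.I_maximal[OF I sub] nx additive_subgroup.a_subset[OF ideal.axioms(1)[OF I]] by blast
    then have "\<one> \<in> ?N" by simp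
    then obtain m b where m: "m \<in> M" and b: "b \<in> carrier R" and eq: "\<one> = m \<oplus> b \<otimes> x"
      unfolding set_add_def' cgenideal_def by blast
    have mc: "m \<in> carrier R" using m by (rule M.a_Hcarr)
    have "m = (m \<oplus> b \<otimes> x) \<oplus> (\<ominus> b) \<otimes> x" using mc b xc by algebra
    also have "\<dots> = \<one> \<oplus> (\<ominus> b) \<otimes> x" by (simp only: eq[symmetric])
    also have "\<dots> \<in> Units R" using x b by blast
    finally have u: "m \<in> Units R" .
    have "inv m \<otimes> m \<in> M" using M.I_l_closed[OF m] u by blast
    then have "\<one> \<in> M" using u by simp
    then show False using M.one_imp_carrier M.I_notcarr by auto
  qed
  then show "x \<in> jacobson_radical R" using xc by (auto simp: jacobson_radical_def)
qed

lemma Units_add_jacobson_radical: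
  assumes u: "u \<in> Units R" and x: "x \<in> jacobson_radical R"
  shows "u \<oplus> x \<in> Units R"
proof -
  have xc: "x \<in> carrier R" and w: "\<one> \<oplus> inv u \<otimes> x \<in> Units R"
    using x Units_inv_closed[OF u] unfolding mem_jacobson_radical_iff by blast+
  have uc: "u \<in> carrier R" "inv u \<in> carrier R" using u by auto
  have "u \<otimes> (\<one> \<oplus> inv u \<otimes> x) = u \<oplus> (u \<otimes> inv u) \<otimes> x"
    using xc uc by (simp add: r_distr m_assoc)
  also have "\<dots> = u \<oplus> x" using u xc by simp
  finally have "u \<oplus> x = u \<otimes> (\<one> \<oplus> inv u \<otimes> x)" by (rule sym)
  then show ?thesis using Units_m_closed[OF u w] by simp
qed

section \<open>J-regularity expressed by elements\<close>

text \<open>Cosets are eliminated here, so that all later arguments compute in \<open>R\<close>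
  itself, up to membership in an ideal.\<close>

lemma regular_ring_Quot_iff:
  assumes "ideal I R"
  shows "regular_ring (R Quot I) \<longleftrightarrow>
    (\<forall>x\<in>carrier R. \<exists>y\<in>carrier R. x \<otimes> x \<otimes> y \<ominus> x \<in> I)"
proof -
  interpret I: ideal I R by (rule assms)
  let ?Q = "R Quot I"
  interpret h: ring_hom_cring R ?Q "(+>) I"
    by (rule I.rcos_ring_hom_cring[OF is_cring])
  have carr: "carrier ?Q = (\<lambda>x. I +> x) ` carrier R"
    unfolding FactRing_def A_RCOSETS_def' by auto
  have "(I +> x) [^]\<^bsub>?Q\<^esub> (2::nat) \<otimes>\<^bsub>?Q\<^esub> (I +> y) = I +> x \<longleftrightarrow> x \<otimes> x \<otimes> y \<ominus> x \<in> I"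
    if "x \<in> carrier R" "y \<in> carrier R" for x y
  proof -
    have "(I +> x) [^]\<^bsub>?Q\<^esub> (2::nat) \<otimes>\<^bsub>?Q\<^esub> (I +> y) = I +> (x \<otimes> x \<otimes> y)"
      using that by (simp add: numeral_2_eq_2)
    then show ?thesis
      using quotient_eq_iff_same_a_r_cos[OF assms, of "x \<otimes> x \<otimes> y" x] that by auto
  qed
  then show ?thesis by (simp add: regular_ring_def carr)
qed

text \<open>In a commutative regular ring every element is a unit times an idempotent, so \<open>x\<^sup>2 = u x\<close>
  with a unit \<open>u\<close>, and units lift modulo the Jacobson radical.\<close>

lemma J_regular_iff_unit:
  "J_regular R \<longleftrightarrow>
    (\<forall>x\<in>carrier R. \<exists>u\<in>Units R. \<exists>c\<in>jacobson_radical R. x \<otimes> x = u \<otimes> x \<oplus> c)"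
proof -
  interpret J: ideal "jacobson_radical R" R by (rule ideal_jacobson_radical)
  have "(\<exists>y\<in>carrier R. x \<otimes> x \<otimes> y \<ominus> x \<in> jacobson_radical R) \<longleftrightarrow>
      (\<exists>u\<in>Units R. \<exists>c\<in>jacobson_radical R. x \<otimes> x = u \<otimes> x \<oplus> c)"
    if x: "x \<in> carrier R" for x
  proof
    assume "\<exists>y\<in>carrier R. x \<otimes> x \<otimes> y \<ominus> x \<in> jacobson_radical R"
    then obtain y where y: "y \<in> carrier R" and t: "x \<otimes> x \<otimes> y \<ominus> x \<in> jacobson_radical R" by blast
    define n where "n = \<one> \<ominus> x \<otimes> y"
    have n: "n \<in> carrier R" using x y by (simp add: n_def)
    have "n \<otimes> x = \<ominus> (x \<otimes> x \<otimes> y \<ominus> x)" unfolding n_def using x y by algebra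
    then have c: "n \<otimes> x \<in> jacobson_radical R" using t by simp
    \<comment> \<open>Modulo the radical, \<open>x y\<close> and \<open>n\<close> are complementary
      idempotents. On the part of \<open>x y\<close> the inverse of \<open>x\<close> is
      \<open>x y y\<close>; on the part of \<open>n\<close> both \<open>?u\<close> and
      \<open>?v\<close> act as \<open>1\<close>. So \<open>?v\<close> inverts \<open>?u\<close>
      modulo the radical.\<close>
    let ?u = "x \<oplus> n" and ?v = "x \<otimes> y \<otimes> y \<oplus> n"
    \<comment> \<open>The cross term that completes the square \<open>(n + x y)^2 = 1\<close> inside
      \<open>?u ?v\<close>.\<close>
    let ?d = "(y \<oplus> y) \<otimes> (n \<otimes> x)"
    have d: "?d \<in> jacobson_radical R" using c y by (simp add: J.I_l_closed)
    have one: "n \<oplus> x \<otimes> y = \<one>" unfolding n_def using x y by algebra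
    have "?u \<otimes> ?v \<oplus> ?d =
        (n \<oplus> x \<otimes> y) \<otimes> (n \<oplus> x \<otimes> y) \<oplus> (\<one> \<oplus> y \<otimes> y) \<otimes> (n \<otimes> x)"
      using x y n by (simp add: l_distr r_distr a_ac m_ac)
    also have "\<dots> = \<one> \<oplus> (\<one> \<oplus> y \<otimes> y) \<otimes> (n \<otimes> x)"
      using x y n by (simp add: one)
    finally have "?u \<otimes> ?v \<oplus> ?d = \<one> \<oplus> (\<one> \<oplus> y \<otimes> y) \<otimes> (n \<otimes> x)" .
    moreover have "\<one> \<oplus> (\<one> \<oplus> y \<otimes> y) \<otimes> (n \<otimes> x) \<in> Units R"
      using c y unfolding mem_jacobson_radical_iff by blast
    ultimately have "?u \<otimes> ?v \<oplus> ?d \<in> Units R" by simp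
    then have "(?u \<otimes> ?v \<oplus> ?d) \<oplus> (\<ominus> ?d) \<in> Units R"
      by (rule Units_add_jacobson_radical) (use d in simp)
    also have "(?u \<otimes> ?v \<oplus> ?d) \<oplus> (\<ominus> ?d) = ?u \<otimes> ?v"
      using x y n by (simp add: a_assoc r_neg)
    finally have "?u \<in> Units R" by (rule unit_factor) (use x y n in simp_all)
    moreover have "x \<otimes> x = ?u \<otimes> x \<oplus> (\<ominus> (n \<otimes> x))"
      using x n by (simp add: l_distr a_assoc r_neg)
    moreover have "\<ominus> (n \<otimes> x) \<in> jacobson_radical R" using c by simp
    ultimately show "\<exists>u\<in>Units R. \<exists>c\<in>jacobson_radical R. x \<otimes> x = u \<otimes> x \<oplus> c" by blast
  next
    assume "\<exists>u\<in>Units R. \<exists>c\<in>jacobson_radical R. x \<otimes> x = u \<otimes> x \<oplus> c"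
    then obtain u c where u: "u \<in> Units R" and c: "c \<in> jacobson_radical R"
      and eq: "x \<otimes> x = u \<otimes> x \<oplus> c" by blast
    have cc: "c \<in> carrier R" using c by (rule J.Icarr)
    have uc: "u \<in> carrier R" "inv u \<in> carrier R" using u by auto
    have "x \<otimes> x \<otimes> inv u = (inv u \<otimes> u) \<otimes> x \<oplus> inv u \<otimes> c"
      unfolding eq using x cc uc by (simp add: l_distr r_distr m_ac)
    then have "x \<otimes> x \<otimes> inv u = x \<oplus> inv u \<otimes> c" using u x by simp
    then have "x \<otimes> x \<otimes> inv u \<ominus> x = inv u \<otimes> c"
      using x cc uc by (simp add: a_minus_def a_ac r_neg1 r_neg2)
    also have "\<dots> \<in> jacobson_radical R" using c u by (simp add: J.I_l_closed)
    finally show "\<exists>y\<in>carrier R. x \<otimes> x \<otimes> y \<ominus> x \<in> jacobson_radical R"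
      using u by blast
  qed
  then show ?thesis
    by (simp add: J_regular_def regular_ring_Quot_iff[OF ideal_jacobson_radical])
qed

end

section \<open>Units and powers in integral extensions\<close>

lemma (in ring) Units_minus:
  assumes "u \<in> Units R"
  shows "\<ominus> u \<in> Units R"
proof -
  have "\<ominus> u = \<ominus> \<one> \<otimes> u" using Units_closed[OF assms] by (simp add: l_minus)
  then show ?thesis using Units_m_closed[OF Units_minus_one_closed assms] by simp
qed

text \<open>Addition and multiplication are inherited literally, but negation is defined by a
  description that refers to the carrier; uniqueness of inverses identifies the two
  versions.\<close>

lemma (in ring) subring_minus:
  assumes K: "subring K R" and x: "x \<in> K"
  shows "\<ominus>\<^bsub>R\<lparr>carrier := K\<rparr>\<^esub> x = \<ominus> x"
proof -
  interpret A: ring "R\<lparr>carrier := K\<rparr>" by (rule subring_is_ring[OF K])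
  have "x \<in> carrier R" using subringE(1)[OF K] x by blast
  then show ?thesis
    using A.minus_equality[of "\<ominus> x" x] subringE(5)[OF K x] x by (simp add: l_neg)
qed

text \<open>By the unit criterion it suffices that \<open>1 + s x\<close> divides a unit of
  \<open>K\<close>. Such a multiple is extracted from a monic equation for \<open>s\<close>,
  multiplied by a power of \<open>x\<close>.\<close>

lemma (in cring) jacobson_radical_le_if_integral:
  assumes K: "subring K R" and int: "integral_extension K R"
  shows "jacobson_radical (R\<lparr>carrier := K\<rparr>) \<subseteq> jacobson_radical R"
proof
  let ?A = "R\<lparr>carrier := K\<rparr>"
  have Kc: "K \<subseteq> carrier R" by (rule subringE(1)[OF K])
  interpret A: cring ?A
    using subcring_iff[OF Kc] subcringI'[OF K] by blast
  interpret JA: ideal "jacobson_radical ?A" ?A by (rule A.ideal_jacobson_radical)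
  fix x assume x: "x \<in> jacobson_radical ?A"
  have xK: "x \<in> K" using JA.Icarr[OF x] by simp
  then have xc: "x \<in> carrier R" using Kc by blast
  have unitA: "u \<in> Units R" if "u \<in> Units ?A" for u
    using that Kc unfolding Units_def by auto
  have "\<one> \<oplus> s \<otimes> x \<in> Units R" if s: "s \<in> carrier R" for s
  proof -
    let ?w = "\<one> \<oplus> s \<otimes> x"
    have w: "?w \<in> carrier R" using s xc by simp
    \<comment> \<open>Modulo \<open>w\<close> the element \<open>s x\<close> is \<open>- 1\<close>, so \<open>x\<^sup>N p(s)\<close> becomes \<open>\<plusminus>1\<close> plus a multiple of \<open>x\<close> in \<open>K\<close>.\<close>
    have horner: "\<exists>N q u. q \<in> carrier R \<and> u \<in> Units ?A \<and>
        x [^] (N::nat) \<otimes> eval p s = ?w \<otimes> q \<oplus> u"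
      if "set p \<subseteq> K" "p \<noteq> []" "lead_coeff p = \<one>" for p
      using that
    proof (induction p rule: rev_induct)
      case Nil
      then show ?case by simp
    next
      case (snoc a p)
      then have a: "a \<in> K" and p: "set p \<subseteq> K" by auto
      then have ac: "a \<in> carrier R" and pc: "set p \<subseteq> carrier R" using Kc by auto
      show ?case
      proof (cases "p = []")
        case True
        then have "x [^] (0::nat) \<otimes> eval (p @ [a]) s = ?w \<otimes> \<zero> \<oplus> \<one>"
          using snoc.prems w s by simp
        moreover have "\<one> \<in> Units ?A" using A.Units_one_closed by simp
        ultimately show ?thesis by blast
      next
        case False
        then have "lead_coeff p = \<one>" using snoc.prems by simp
        then obtain N q u where q: "q \<in> carrier R" and u: "u \<in> Units ?A"
          and eq: "x [^] (N::nat) \<otimes> eval p s = ?w \<otimes> q \<oplus> u"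
          using snoc.IH[OF p False] by blast
        define P where "P = eval p s"
        have P: "P \<in> carrier R" unfolding P_def by (rule eval_in_carrier[OF pc s])
        define z where "z = x [^] N"
        have z: "z \<in> carrier R" "z \<in> K"
          using xc A.nat_pow_closed[of x N] xK unfolding z_def nat_pow_consistent[symmetric] by auto
        have uK: "u \<in> K" using A.Units_closed[OF u] by simp
        then have uc: "u \<in> carrier R" using Kc by blast
        \<comment> \<open>With \<open>t = s x = ?w - 1\<close> one has
          \<open>(?w q + u) t + a z x = ?w (q t + u) + v\<close>. Since \<open>x\<close> is in the
          radical of \<open>?A\<close>, the new constant \<open>v\<close> is again a unit
          there.\<close>
        define v where "v = \<ominus> u \<oplus> a \<otimes> z \<otimes> x"
        define t where "t = s \<otimes> x"
        have t: "t \<in> carrier R" unfolding t_def using s xc by simp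
        have vA: "v = \<ominus>\<^bsub>?A\<^esub> u \<oplus>\<^bsub>?A\<^esub> (a \<otimes>\<^bsub>?A\<^esub> z) \<otimes>\<^bsub>?A\<^esub> x"
          unfolding v_def by (simp add: subring_minus[OF K uK])
        have "v \<in> Units ?A"
          unfolding vA by (intro A.Units_add_jacobson_radical A.Units_minus u JA.I_l_closed x)
            (use subringE(6)[OF K a z(2)] in simp)
        moreover have "x [^] (Suc N) \<otimes> eval (p @ [a]) s = ?w \<otimes> (q \<otimes> t \<oplus> u) \<oplus> v"
        proof -
          have "x [^] (Suc N) \<otimes> eval (p @ [a]) s = (z \<otimes> P) \<otimes> t \<oplus> a \<otimes> z \<otimes> x"
            using z P s xc ac eval_append_aux[OF pc ac s]
            by (simp add: z_def[symmetric] P_def[symmetric] t_def r_distr m_ac)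
          also have "\<dots> = (?w \<otimes> q \<oplus> u) \<otimes> t \<oplus> a \<otimes> z \<otimes> x"
            using eq by (simp only: z_def P_def)
          also have "\<dots> = ?w \<otimes> (q \<otimes> t \<oplus> u) \<oplus> v"
            unfolding v_def t_def[symmetric]
            using q uc t ac z xc by (simp add: l_distr r_distr a_ac m_ac r_neg r_neg1 r_neg2)
          finally show ?thesis .
        qed
        moreover have "q \<otimes> t \<oplus> u \<in> carrier R" using q t uc by simp
        ultimately show ?thesis by blast
      qed
    qed
    obtain p where p: "p \<in> carrier (K[X])" "p \<noteq> []" "lead_coeff p = \<one>" "eval p s = \<zero>"
      using int s unfolding integral_extension_def by blast
    have "set p \<subseteq> K"
      using p(1,2) unfolding univ_poly_carrier[symmetric] polynomial_def by blast
    from horner[OF this p(2,3)] obtain N q u where q: "q \<in> carrier R" and u: "u \<in> Units R"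
      and eq: "x [^] (N::nat) \<otimes> eval p s = ?w \<otimes> q \<oplus> u"
      using unitA by blast
    have uc: "u \<in> carrier R" using u by blast
    have "?w \<otimes> (\<ominus> q) = \<ominus> (?w \<otimes> q)" using w q by (rule r_minus)
    also have "\<dots> = u"
    proof -
      have "?w \<otimes> q \<oplus> u = \<zero>" using eq p(4) xc by simp
      then show ?thesis using w q uc by (metis m_closed minus_equality minus_minus)
    qed
    finally have "?w \<otimes> (\<ominus> q) \<in> Units R" using u by simp
    then show ?thesis by (rule unit_factor) (use w q in simp_all)
  qed
  then show "x \<in> jacobson_radical R" using xc unfolding mem_jacobson_radical_iff by blast
qed

text \<open>For a zero-dimensional base ring, an element \<open>s\<close> integral over it satisfies
  \<open>s\<^sup>N \<in> s\<^sup>N\<^sup>+\<^sup>1 R\<close>. Given the constant coefficient \<open>a\<close>, split \<open>1 = v a + f\<close>: on the part \<open>v a\<close> the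
  relation is solved for \<open>s\<^sup>k\<close>, on the part \<open>f\<close> the constant coefficient disappears and the
  remaining relation has lower degree.\<close>

lemma (in cring) power_descends_mod_ideal:
  assumes I: "ideal I R" and K: "K \<subseteq> carrier R" and s: "s \<in> carrier R"
    and reg: "\<And>a. a \<in> K \<Longrightarrow>
      \<exists>v\<in>carrier R. \<exists>f\<in>carrier R. v \<otimes> a \<oplus> f = \<one> \<and> f \<otimes> a \<in> I"
    and "set p \<subseteq> K" "p \<noteq> []" "lead_coeff p = \<one>"
    and "c \<in> carrier R" "c \<otimes> s [^] (k::nat) \<otimes> eval p s \<in> I"
  shows "\<exists>N y. y \<in> carrier R \<and> c \<otimes> s [^] (N::nat) \<oplus> s [^] (Suc N) \<otimes> y \<in> I"
  using assms(5-)
\<comment> \<open>The leading coefficient comes first, so \<open>rev_induct\<close> strips the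
  constant coefficient. Each step replaces \<open>c\<close> by \<open>f c\<close> and
  \<open>k\<close> by \<open>Suc k\<close>, hence the generalization.\<close>
proof (induction p arbitrary: c k rule: rev_induct)
  case Nil
  then show ?case by simp
next
  case (snoc a p)
  interpret I: ideal I R by (rule I)
  from snoc.prems have a: "a \<in> K" and p: "set p \<subseteq> K" and c: "c \<in> carrier R" by auto
  then have ac: "a \<in> carrier R" and pc: "set p \<subseteq> carrier R" using K by auto
  show ?case
  proof (cases "p = []")
    case True
    \<comment> \<open>A monic constant is \<open>1\<close>, so the assumption itself gives the claim
      with \<open>y = 0\<close>.\<close>
    then have "c \<otimes> s [^] k \<oplus> s [^] (Suc k) \<otimes> \<zero> \<in> I"
      using snoc.prems s c by simp
    then show ?thesis by blast
  next
    case False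
    then have lc: "lead_coeff p = \<one>" using snoc.prems by simp
    obtain v f where v: "v \<in> carrier R" and f: "f \<in> carrier R" and vf: "v \<otimes> a \<oplus> f = \<one>"
      and fa: "f \<otimes> a \<in> I"
      using reg[OF a] by blast
    define P where "P = eval p s"
    have P: "P \<in> carrier R" unfolding P_def by (rule eval_in_carrier[OF pc s])
    define z where "z = s [^] k"
    have z: "z \<in> carrier R" unfolding z_def using s by simp
    have h: "c \<otimes> z \<otimes> (P \<otimes> s \<oplus> a) \<in> I"
      using snoc.prems(5) unfolding eval_append_aux[OF pc ac s] P_def z_def .
    have "v \<otimes> (c \<otimes> z \<otimes> (P \<otimes> s \<oplus> a)) \<in> I" using h v by (rule I.I_l_closed)
    also have "v \<otimes> (c \<otimes> z \<otimes> (P \<otimes> s \<oplus> a)) = v \<otimes> a \<otimes> c \<otimes> z \<oplus> z \<otimes> s \<otimes> (v \<otimes> c \<otimes> P)"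
      using v c z P s ac by (simp add: r_distr m_ac a_ac)
    finally have d1: "v \<otimes> a \<otimes> c \<otimes> z \<oplus> z \<otimes> s \<otimes> (v \<otimes> c \<otimes> P) \<in> I" .
    have fac: "c \<otimes> z \<otimes> (f \<otimes> a) \<in> I" using fa c z by (simp add: I.I_l_closed)
    have "f \<otimes> (c \<otimes> z \<otimes> (P \<otimes> s \<oplus> a)) \<oplus> \<ominus> (c \<otimes> z \<otimes> (f \<otimes> a)) \<in> I"
      using I.I_l_closed[OF h f] fac by simp
    also have "f \<otimes> (c \<otimes> z \<otimes> (P \<otimes> s \<oplus> a)) \<oplus> \<ominus> (c \<otimes> z \<otimes> (f \<otimes> a)) = f \<otimes> c \<otimes> (z \<otimes> s) \<otimes> P"
      using f c z P s ac by (simp add: r_distr m_ac a_assoc r_neg)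
    finally have "f \<otimes> c \<otimes> s [^] (Suc k) \<otimes> eval p s \<in> I"
      by (simp add: z_def P_def)
    from snoc.IH[OF p False lc _ this] obtain N y where y: "y \<in> carrier R"
      and d2: "f \<otimes> c \<otimes> s [^] (N::nat) \<oplus> s [^] (Suc N) \<otimes> y \<in> I"
      using f c by auto
    define w where "w = s [^] N"
    have w: "w \<in> carrier R" unfolding w_def using s by simp
    have d2: "f \<otimes> c \<otimes> w \<oplus> w \<otimes> s \<otimes> y \<in> I" using d2 by (simp add: w_def)
    \<comment> \<open>Both relations are raised to the common exponent \<open>k + N\<close> and
      added; the coefficients \<open>v a\<close> and \<open>f\<close> then sum to
      \<open>1\<close>.\<close>
    have "w \<otimes> (v \<otimes> a \<otimes> c \<otimes> z \<oplus> z \<otimes> s \<otimes> (v \<otimes> c \<otimes> P))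
        \<oplus> z \<otimes> (f \<otimes> c \<otimes> w \<oplus> w \<otimes> s \<otimes> y) \<in> I"
      using I.I_l_closed[OF d1 w] I.I_l_closed[OF d2 z] by simp
    also have "w \<otimes> (v \<otimes> a \<otimes> c \<otimes> z \<oplus> z \<otimes> s \<otimes> (v \<otimes> c \<otimes> P))
        \<oplus> z \<otimes> (f \<otimes> c \<otimes> w \<oplus> w \<otimes> s \<otimes> y)
        = (v \<otimes> a \<oplus> f) \<otimes> (c \<otimes> (z \<otimes> w)) \<oplus> (z \<otimes> w) \<otimes> s \<otimes> (v \<otimes> c \<otimes> P \<oplus> y)"
      using v f c z w P s ac y by (simp add: l_distr r_distr m_ac a_ac)
    also have "\<dots> = c \<otimes> s [^] (k + N) \<oplus> s [^] Suc (k + N) \<otimes> (v \<otimes> c \<otimes> P \<oplus> y)"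
      using s c z w unfolding vf z_def w_def by (simp add: nat_pow_mult)
    finally have "c \<otimes> s [^] (k + N) \<oplus> s [^] Suc (k + N) \<otimes> (v \<otimes> c \<otimes> P \<oplus> y) \<in> I" .
    moreover have "v \<otimes> c \<otimes> P \<oplus> y \<in> carrier R" using v c P y by simp
    ultimately show ?thesis by (intro exI conjI)
  qed
qed

section \<open>Strongly local extensions with J-regular overring\<close>

text \<open>Here \<open>R\<close> is the overring and \<open>K\<close> the subring; the final
  theorem calls them \<open>S\<close> and \<open>R\<close>.\<close>

locale strongly_local_subring = cring +
  fixes K
  assumes subring: "subring K R"
    and Units_eq: "Units (R\<lparr>carrier := K\<rparr>) = Units R"
begin

abbreviation "A \<equiv> R\<lparr>carrier := K\<rparr>"

lemma K_sub: "K \<subseteq> carrier R"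
  by (rule subringE(1)[OF subring])

sublocale A: cring A
  using subcring_iff[OF K_sub] subcringI'[OF subring] by blast

sublocale J: ideal "jacobson_radical R" R
  by (rule ideal_jacobson_radical)

lemma Units_in_K: "u \<in> Units R \<Longrightarrow> u \<in> K"
  using A.Units_closed by (simp add: Units_eq)

lemma jacobson_radical_in_K: "jacobson_radical R \<subseteq> K"
proof
  fix x assume x: "x \<in> jacobson_radical R"
  have "\<one> \<oplus> x \<in> K" by (intro Units_in_K Units_add_jacobson_radical x) simp
  then have "\<ominus> \<one> \<oplus> (\<one> \<oplus> x) \<in> K" using subringE(3,5,7)[OF subring] by blast
  then show "x \<in> K" using J.Icarr[OF x] by (simp add: r_neg1)
qed

text \<open>In the unit criterion the subring only tests multipliers from \<open>K\<close>, and the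
  units agree.\<close>

lemma jacobson_radical_le: "jacobson_radical R \<subseteq> jacobson_radical A"
proof
  fix x assume x: "x \<in> jacobson_radical R"
  then have "\<forall>a\<in>carrier R. \<one> \<oplus> a \<otimes> x \<in> Units R"
    unfolding mem_jacobson_radical_iff by blast
  moreover have "x \<in> K" using x jacobson_radical_in_K by blast
  ultimately show "x \<in> jacobson_radical A"
    unfolding A.mem_jacobson_radical_iff Units_eq using K_sub by auto
qed

lemma J_regular_unit:
  assumes "J_regular R" "x \<in> carrier R"
  obtains u c where "u \<in> Units R" "u \<in> K" "c \<in> jacobson_radical R" "c \<in> K" "x \<otimes> x = u \<otimes> x \<oplus> c"
  using assms Units_in_K jacobson_radical_in_K unfolding J_regular_iff_unit by blast

text \<open>From \<open>x^2 = u x + c\<close> follows \<open>(x - u) x = c\<close>. For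
  \<open>x\<close> in the radical of \<open>A\<close> the factor \<open>x - u\<close> is a unit, so
  \<open>x\<close> is a multiple of \<open>c\<close>.\<close>

lemma jacobson_radical_eq:
  assumes "J_regular R"
  shows "jacobson_radical A = jacobson_radical R"
proof (rule equalityI[OF subsetI jacobson_radical_le])
  fix x assume x: "x \<in> jacobson_radical A"
  then have xK: "x \<in> K" by (simp add: jacobson_radical_def)
  then have xc: "x \<in> carrier R" using K_sub by blast
  obtain u c where u: "u \<in> Units R" and c: "c \<in> jacobson_radical R"
    and eq: "x \<otimes> x = u \<otimes> x \<oplus> c"
    using J_regular_unit[OF assms xc] by metis
  have uc: "u \<in> carrier R" using u by blast
  have cc: "c \<in> carrier R" using J.Icarr[OF c] .
  have "\<ominus> u \<in> Units A" using Units_minus[OF u] by (simp add: Units_eq)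
  then have "\<ominus> u \<oplus> x \<in> Units A"
    using A.Units_add_jacobson_radical[OF _ x] by simp
  then have v: "\<ominus> u \<oplus> x \<in> Units R" (is "?v \<in> _") by (simp add: Units_eq)
  have "?v \<otimes> x = c"
    using xc uc cc by (simp add: l_distr eq l_minus r_neg1)
  then have "inv ?v \<otimes> c = (inv ?v \<otimes> ?v) \<otimes> x"
    using xc uc Units_inv_closed[OF v] by (simp add: m_assoc)
  also have "\<dots> = x" using v xc by simp
  finally have "x = inv ?v \<otimes> c" by (rule sym)
  then show "x \<in> jacobson_radical R" using J.I_l_closed[OF c Units_inv_closed[OF v]] by simp
qed

text \<open>The unit characterization involves only the units and the radical, which both rings
  share, so it restricts to \<open>K\<close>.\<close>

lemma J_regular_subring:
  assumes "J_regular R"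
  shows "J_regular A"
  unfolding A.J_regular_iff_unit jacobson_radical_eq[OF assms] Units_eq
  using assms K_sub unfolding J_regular_iff_unit by auto

lemma seminormal_if_J_regular:
  assumes "J_regular R"
  shows "seminormal_extension K R"
  unfolding seminormal_extension_def
proof (intro ballI impI)
  fix b assume b: "b \<in> carrier R" and bb: "b [^] (2::nat) \<in> K \<and> b [^] (3::nat) \<in> K"
  then have "b \<otimes> b \<in> K" by (simp add: numeral_2_eq_2)
  obtain u c where u: "u \<in> Units R" and c: "c \<in> jacobson_radical R" "c \<in> K"
    and eq: "b \<otimes> b = u \<otimes> b \<oplus> c"
    using J_regular_unit[OF assms b] by metis
  have uc: "u \<in> carrier R" "inv u \<in> carrier R" using u by auto
  have cc: "c \<in> carrier R" using J.Icarr[OF c(1)] .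
  have "inv u \<otimes> (b \<otimes> b \<oplus> \<ominus> c) \<in> K"
    using \<open>b \<otimes> b \<in> K\<close> c(2) Units_in_K[OF Units_inv_Units[OF u]] subringE[OF subring] by simp
  also have "inv u \<otimes> (b \<otimes> b \<oplus> \<ominus> c) = (inv u \<otimes> u) \<otimes> b"
    unfolding eq using b uc cc by (simp add: a_assoc r_neg m_assoc)
  also have "\<dots> = b" using u b by simp
  finally show "b \<in> K" .
qed

lemma integral_if_J_regular:
  assumes "J_regular R" and nz: "\<one> \<noteq> \<zero>"
  shows "integral_extension K R"
  unfolding integral_extension_def
proof
  fix s assume s: "s \<in> carrier R"
  obtain u c where u: "u \<in> Units R" "u \<in> K" and c: "c \<in> jacobson_radical R" "c \<in> K"
    and eq: "s \<otimes> s = u \<otimes> s \<oplus> c"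
    using J_regular_unit[OF assms(1) s] by metis
  have uc: "u \<in> carrier R" "c \<in> carrier R" using u c K_sub by auto
  let ?p = "[\<one>, \<ominus> u, \<ominus> c]"
  \<comment> \<open>A nonempty coefficient list must have nonzero leading coefficient; here that is
    \<open>nz\<close>.\<close>
  have "?p \<in> carrier (K[X])"
    unfolding univ_poly_carrier[symmetric] polynomial_def
    using nz u c subringE[OF subring] by simp
  moreover have "eval ?p s = \<zero>"
    using s uc by (simp add: numeral_2_eq_2 eq l_minus a_ac r_neg r_neg1 r_neg2)
  ultimately show "\<exists>p\<in>carrier (K[X]). p \<noteq> [] \<and> lead_coeff p = \<one> \<and> eval p s = \<zero>"
    by (intro bexI[of _ ?p]) simp_all
qed

section \<open>From integrality and seminormality to J-regularity\<close>

text \<open>The radical is an ideal of \<open>R\<close> inside \<open>K\<close>, so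
  \<open>b^2\<close> and \<open>b^3\<close> lie in \<open>K\<close> and seminormality puts
  \<open>b\<close> there. Then \<open>b^2 = u b + c\<close> exhibits \<open>u b\<close> as an
  element of the radical.\<close>

lemma mem_jacobson_radical_if_square:
  assumes reg: "J_regular A" and sn: "seminormal_extension K R"
    and J: "jacobson_radical A = jacobson_radical R"
    and b: "b \<in> carrier R" and bb: "b \<otimes> b \<in> jacobson_radical R"
  shows "b \<in> jacobson_radical R"
proof -
  have "b [^] (2::nat) \<in> K"
    using bb b jacobson_radical_in_K by (auto simp: numeral_2_eq_2)
  moreover have "b [^] (3::nat) \<in> K"
    using J.I_r_closed[OF bb b] b jacobson_radical_in_K by (auto simp: numeral_3_eq_3)
  ultimately have "b \<in> K" using sn b unfolding seminormal_extension_def by blast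
  then obtain u c where u: "u \<in> Units R" and c: "c \<in> jacobson_radical R"
    and eq: "b \<otimes> b = u \<otimes> b \<oplus> c"
    using reg unfolding A.J_regular_iff_unit J Units_eq by auto
  have uc: "u \<in> carrier R" "inv u \<in> carrier R" using u by auto
  have cc: "c \<in> carrier R" using J.Icarr[OF c] .
  have "inv u \<otimes> (b \<otimes> b \<oplus> \<ominus> c) \<in> jacobson_radical R"
    using bb c uc by (simp add: J.I_l_closed)
  also have "inv u \<otimes> (b \<otimes> b \<oplus> \<ominus> c) = (inv u \<otimes> u) \<otimes> b"
    unfolding eq using b uc cc by (simp add: a_assoc r_neg m_assoc)
  also have "\<dots> = b" using u b by simp
  finally show ?thesis .
qed

lemma J_regular_if_integral_seminormal:
  assumes reg: "J_regular A" and int: "integral_extension K R" and sn: "seminormal_extension K R"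
  shows "J_regular R"
proof -
  have J: "jacobson_radical A = jacobson_radical R"
    using jacobson_radical_le jacobson_radical_le_if_integral[OF subring int] by blast
  have split: "\<exists>v\<in>carrier R. \<exists>f\<in>carrier R. v \<otimes> a \<oplus> f = \<one> \<and> f \<otimes> a \<in> jacobson_radical R"
    if a: "a \<in> K" for a
  proof -
    obtain u c where u: "u \<in> Units R" and c: "c \<in> jacobson_radical R"
      and eq: "a \<otimes> a = u \<otimes> a \<oplus> c"
      using reg a unfolding A.J_regular_iff_unit J Units_eq by auto
    have uc: "u \<in> carrier R" "inv u \<in> carrier R" using u by auto
    have cc: "c \<in> carrier R" using J.Icarr[OF c] .
    have ac: "a \<in> carrier R" using a K_sub by blast
    \<comment> \<open>Modulo the radical \<open>inv u a\<close> is idempotent, by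
      \<open>a^2 = u a + c\<close>; \<open>?f\<close> is its complement and annihilates
      \<open>a\<close>.\<close>
    let ?f = "\<one> \<oplus> \<ominus> (inv u \<otimes> a)"
    have "inv u \<otimes> (a \<otimes> a) = (inv u \<otimes> u) \<otimes> a \<oplus> inv u \<otimes> c"
      unfolding eq using ac uc cc by (simp add: r_distr m_assoc)
    then have "inv u \<otimes> (a \<otimes> a) = a \<oplus> inv u \<otimes> c" using u ac by simp
    then have "?f \<otimes> a = \<ominus> (inv u \<otimes> c)"
      using ac uc cc by (simp add: l_distr l_minus m_assoc minus_add r_neg2)
    then have "?f \<otimes> a \<in> jacobson_radical R" using J.I_l_closed[OF c uc(2)] by simp
    moreover have "inv u \<otimes> a \<oplus> ?f = \<one>"
      using ac uc by (simp add: a_ac r_neg)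
    moreover have "?f \<in> carrier R" using ac uc by simp
    ultimately show ?thesis using uc(2) by blast
  qed
  have radical: "b \<in> jacobson_radical R"
    if b: "b \<in> carrier R" and "b [^] Suc n \<in> jacobson_radical R" for b n
    using that(2)
  proof (induction n)
    case 0
    then show ?case using b by simp
  next
    case (Suc n)
    \<comment> \<open>As \<open>2 (n + 1) = n + (n + 2)\<close>, one application of the square case
      lowers the exponent by one.\<close>
    have "b [^] Suc n \<otimes> b [^] Suc n = b [^] n \<otimes> b [^] Suc (Suc n)"
      using b by (simp add: nat_pow_mult m_ac)
    also have "\<dots> \<in> jacobson_radical R" using Suc.prems b by (simp add: J.I_l_closed)
    finally have "b [^] Suc n \<in> jacobson_radical R"
      by (rule mem_jacobson_radical_if_square[OF reg sn J nat_pow_closed[OF b]])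
    then show ?case by (rule Suc.IH)
  qed
  have "\<exists>y\<in>carrier R. s \<otimes> s \<otimes> y \<ominus> s \<in> jacobson_radical R" if s: "s \<in> carrier R" for s
  proof -
    obtain p where p: "p \<in> carrier (K[X])" "p \<noteq> []" "lead_coeff p = \<one>" "eval p s = \<zero>"
      using int s unfolding integral_extension_def by blast
    have pK: "set p \<subseteq> K"
      using p(1,2) unfolding univ_poly_carrier[symmetric] polynomial_def by blast
    have "\<one> \<otimes> s [^] (0::nat) \<otimes> eval p s \<in> jacobson_radical R" using p(4) by simp
    from power_descends_mod_ideal[OF ideal_jacobson_radical K_sub s split pK p(2,3) _ this]
    obtain N y where y: "y \<in> carrier R"
      and d: "\<one> \<otimes> s [^] (N::nat) \<oplus> s [^] (Suc N) \<otimes> y \<in> jacobson_radical R"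
      by auto
    define q where "q = \<one> \<oplus> s \<otimes> y"
    have q: "q \<in> carrier R" using s y by (simp add: q_def)
    \<comment> \<open>The descent relation says that \<open>s^N q\<close> is in the radical. It
      divides \<open>(s q)^(N + 1)\<close>, so \<open>s q\<close> is in the radical too.\<close>
    have "(s \<otimes> q) [^] Suc N = s [^] N \<otimes> q \<otimes> (s \<otimes> q [^] N)"
      using s q by (simp add: nat_pow_distrib m_ac)
    also have "s [^] N \<otimes> q = \<one> \<otimes> s [^] N \<oplus> s [^] (Suc N) \<otimes> y"
      unfolding q_def using s y by (simp add: r_distr m_assoc)
    also have "\<dots> \<otimes> (s \<otimes> q [^] N) \<in> jacobson_radical R"
      using d s q by (simp add: J.I_r_closed)
    finally have "s \<otimes> q \<in> jacobson_radical R"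
      by (rule radical[rotated]) (use s q in simp)
    then have "\<ominus> (s \<otimes> q) \<in> jacobson_radical R" by simp
    \<comment> \<open>Since \<open>s q = s + s^2 y\<close>, the witness for regularity at
      \<open>s\<close> is \<open>- y\<close>.\<close>
    also have "\<ominus> (s \<otimes> q) = s \<otimes> s \<otimes> (\<ominus> y) \<ominus> s" unfolding q_def using s y by algebra
    finally show ?thesis using y by blast
  qed
  then show ?thesis
    unfolding J_regular_def regular_ring_Quot_iff[OF ideal_jacobson_radical] ..
qed

end

theorem theorem5p17:
  fixes S :: "('a, 'b) ring_scheme" and R :: "'a set"
  assumes "cring S" and "\<one>\<^bsub>S\<^esub> \<noteq> \<zero>\<^bsub>S\<^esub>" and "subring R S"
    and "strongly_local_extension R S"
  shows "(J_regular S \<longleftrightarrow>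
            J_regular (S \<lparr>carrier := R\<rparr>) \<and> integral_extension R S \<and> seminormal_extension R S) \<and>
         (J_regular S \<longrightarrow> jacobson_radical (S \<lparr>carrier := R\<rparr>) = jacobson_radical S)"
proof -
  interpret strongly_local_subring S R
    using assms
    by (simp add: strongly_local_subring_def strongly_local_subring_axioms_def
        strongly_local_extension_def)
  show ?thesis
  proof (intro conjI impI iffI)
    assume J: "J_regular S"
    show "J_regular (S \<lparr>carrier := R\<rparr>)" by (rule J_regular_subring[OF J])
    show "integral_extension R S" by (rule integral_if_J_regular[OF J assms(2)])
    show "seminormal_extension R S" by (rule seminormal_if_J_regular[OF J])
    show "jacobson_radical (S \<lparr>carrier := R\<rparr>) = jacobson_radical S"
      by (rule jacobson_radical_eq[OF J])
  next
    assume "J_regular (S \<lparr>carrier := R\<rparr>) \<and> integral_extension R S \<and> seminormal_extension R S"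
    then show "J_regular S" by (elim conjE) (rule J_regular_if_integral_seminormal)
  qed
qed

end
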